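(* Let $\Pi$ be a polyhedral complex in $N_{\mathbb{R}}$ such that its support $|\Pi|$ is a connected polyhedral set satisfying the Minkowski-Weyl condition (i.e. $\operatorname{rec}_p(|\Pi|)=\operatorname{rec}(|\Pi|)$ for every $p\in|\Pi|$, equivalently $|\Pi|=\Delta+\sigma$ with $\Delta$ a finite union of polytopes and $\sigma$ a convex polyhedral cone). Then: (1) $\operatorname{rec}(\Pi)$ is a conic polyhedral complex in $N_{\mathbb{R}}$ and $|\operatorname{rec}(\Pi)|=\operatorname{rec}(|\Pi|)$; (2) $\operatorname{c}(\Pi)$ is a conic polyhedral complex in $N_{\mathbb{R}}\times\mathbb{R}_{\ge0}$ and $|\operatorname{c}(\Pi)|=\operatorname{c}(|\Pi|)$; (3) if in addition $\Pi$ is rational (respectively strongly convex), then both $\operatorname{rec}(\Pi)$ and $\operatorname{c}(\Pi)$ are rational (respectively fans).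
   Context: $N\simeq\mathbb{Z}^n$ is a lattice and $N_{\mathbb{R}}=N\otimes\mathbb{R}$, with dual $M_{\mathbb{R}}$ and pairing $\langle x,u\rangle$. A polyhedron is a finite intersection of closed halfspaces; it is strongly convex if it contains no line, rational if the halfspaces can be defined with rational coefficients. A polyhedral set is a finite union of polyhedra; a polytope is the convex hull of finitely many points; a convex polyhedral cone is the convex cone generated by finitely many vectors. For a polyhedron $\Lambda$ and $x\in M_{\mathbb{R}}$, $\Lambda_x=\{u\in\Lambda\mid\langle x,u\rangle\le\langle x,v\rangle\ \forall v\in\Lambda\}$; a face of $\Lambda$ is a non-empty set of the form $\Lambda_x$. A polyhedral complex is a non-empty collection $\Pi$ of polyhedra such that every face of an element of $\Pi$ is in $\Pi$ and any two elements of $\Pi$ are either disjoint or intersect in a common face; it is rational / strongly convex / conic if all its elements are rational / strongly convex / cones; a fan is a strongly convex conic polyhedral complex. The support is $|\Pi|=\bigcup_{\Lambda\in\Pi}\Lambda$. For a polyhedral set $E$ and $p\in E$: $\operatorname{rec}_p(E)=\{u\mid p+\lambda u\in E\ \forall\lambda\ge0\}$, $\operatorname{rec}(E)=\bigcap_{p\in E}\operatorname{rec}_p(E)$, and $\operatorname{c}(E)=\overline{\mathbb{R}_{>0}(E\times\{1\})}\subset N_{\mathbb{R}}\times\mathbb{R}_{\ge0}$. For a complex $\Pi$: $\operatorname{rec}(\Pi)=\{\operatorname{rec}(\Lambda)\mid\Lambda\in\Pi\}$ and $\operatorname{c}(\Pi)=\{\operatorname{c}(\Lambda)\mid\Lam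bda\in\Pi\}\cup\{\sigma\times\{0\}\mid\sigma\in\operatorname{rec}(\Pi)\}$.
   Formalization: The polyhedral complex is taken to be finite with non-empty members (and n ≥ 1); for the infinite subdivision of the line into unit intervals, or for a complex with the empty polyhedron as a member, part (1) as stated fails. *)

theory Defs
  imports "HOL-Analysis.Analysis"
begin

text \<open>
  Choosing a basis of the lattice, \<open>N = \<int>\<^sup>n\<close> is the integer span of the standard basis of
  \<open>N\<^sub>\<real> = real^'n\<close>, and \<open>M\<^sub>\<real>\<close> is identified with \<open>N\<^sub>\<real>\<close> so that the pairing becomes the inner
  product. The notions below are stated for an arbitrary Euclidean space with the lattice spanned
  by \<^const>\<open>Basis\<close>, since they are also needed for \<open>N\<^sub>\<real> \<times> \<real>\<close>, whose \<^const>\<open>Basis\<close> spans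
  \<open>N \<times> \<int>\<close>.
\<close>

definition rational_vector :: "'a::euclidean_space \<Rightarrow> bool" where
  "rational_vector a \<longleftrightarrow> (\<forall>i\<in>Basis. a \<bullet> i \<in> \<rat>)"

definition rational_polyhedron :: "'a::euclidean_space set \<Rightarrow> bool" where
  "rational_polyhedron S \<longleftrightarrow>
     (\<exists>F. finite F \<and> S = \<Inter>F \<and>
        (\<forall>h\<in>F. \<exists>a b. a \<noteq> 0 \<and> rational_vector a \<and> b \<in> \<rat> \<and> h = {x. a \<bullet> x \<le> b}))"

definition contains_line :: "'a::real_vector set \<Rightarrow> bool" where
  "contains_line S \<longleftrightarrow> (\<exists>p u. u \<noteq> 0 \<and> (\<forall>t::real. p + t *\<^sub>R u \<in> S))"

definition polyhedral_set :: "'a::euclidean_space set \<Rightarrow> bool" where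
  "polyhedral_set E \<longleftrightarrow> (\<exists>P. finite P \<and> (\<forall>\<Lambda>\<in>P. polyhedron \<Lambda>) \<and> E = \<Union>P)"

definition convex_polyhedral_cone :: "'a::euclidean_space set \<Rightarrow> bool" where
  "convex_polyhedral_cone S \<longleftrightarrow> (\<exists>V. finite V \<and> S = convex_cone hull V)"

definition min_locus :: "'a::euclidean_space set \<Rightarrow> 'a \<Rightarrow> 'a set" where
  "min_locus \<Lambda> x = {u\<in>\<Lambda>. \<forall>v\<in>\<Lambda>. x \<bullet> u \<le> x \<bullet> v}"

definition is_face :: "'a::euclidean_space set \<Rightarrow> 'a set \<Rightarrow> bool" where
  "is_face F \<Lambda> \<longleftrightarrow> F \<noteq> {} \<and> (\<exists>x. F = min_locus \<Lambda> x)"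

text \<open>
  Complexes are finite and their members are non-empty. Without finiteness, the subdivision of
  the real line into the intervals \<open>[k, k + 1]\<close>, \<open>k \<in> \<int>\<close>, and their endpoints would be a complex
  with support \<open>\<real>\<close> all of whose recession cones are \<open>{0}\<close>. The empty set would have
  the whole space as its recession cone.
\<close>

definition polyhedral_complex :: "'a::euclidean_space set set \<Rightarrow> bool" where
  "polyhedral_complex \<P> \<longleftrightarrow>
     finite \<P> \<and> \<P> \<noteq> {} \<and>
     (\<forall>\<Lambda>\<in>\<P>. polyhedron \<Lambda> \<and> \<Lambda> \<noteq> {}) \<and>
     (\<forall>\<Lambda>\<in>\<P>. \<forall>F. is_face F \<Lambda> \<longrightarrow> F \<in> \<P>) \<and>
     (\<forall>\<Lambda>\<in>\<P>. \<forall>\<Lambda>'\<in>\<P>. \<Lambda> \<inter> \<Lambda>' = {} \<or> is_face (\<Lambda> \<inter> \<Lambda>') \<Lambda> \<and> is_face (\<Lambda> \<inter> \<Lambda>') \<Lambda>')"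

definition rational_complex :: "'a::euclidean_space set set \<Rightarrow> bool" where
  "rational_complex \<P> \<longleftrightarrow> polyhedral_complex \<P> \<and> (\<forall>\<Lambda>\<in>\<P>. rational_polyhedron \<Lambda>)"

definition strongly_convex_complex :: "'a::euclidean_space set set \<Rightarrow> bool" where
  "strongly_convex_complex \<P> \<longleftrightarrow> polyhedral_complex \<P> \<and> (\<forall>\<Lambda>\<in>\<P>. \<not> contains_line \<Lambda>)"

definition conic_complex :: "'a::euclidean_space set set \<Rightarrow> bool" where
  "conic_complex \<P> \<longleftrightarrow> polyhedral_complex \<P> \<and> (\<forall>\<Lambda>\<in>\<P>. convex_polyhedral_cone \<Lambda>)"

definition fan :: "'a::euclidean_space set set \<Rightarrow> bool" where
  "fan \<P> \<longleftrightarrow> strongly_convex_complex \<P> \<and> conic_complex \<P>"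

definition rec_at :: "'a::real_vector \<Rightarrow> 'a set \<Rightarrow> 'a set" where
  "rec_at p E = {u. \<forall>t\<ge>0::real. p + t *\<^sub>R u \<in> E}"

definition rec_set :: "'a::real_vector set \<Rightarrow> 'a set" where
  "rec_set E = (\<Inter>p\<in>E. rec_at p E)"

definition c_set :: "'a::real_normed_vector set \<Rightarrow> ('a \<times> real) set" where
  "c_set E = closure {t *\<^sub>R (p, 1) |t p. t > 0 \<and> p \<in> E}"

definition rec_complex :: "'a::real_vector set set \<Rightarrow> 'a set set" where
  "rec_complex \<P> = {rec_set \<Lambda> |\<Lambda>. \<Lambda> \<in> \<P>}"

definition c_complex :: "'a::real_normed_vector set set \<Rightarrow> ('a \<times> real) set set" where
  "c_complex \<P> = {c_set \<Lambda> |\<Lambda>. \<Lambda> \<in> \<P>} \<union> {\<sigma> \<times> {0} |\<sigma>. \<sigma> \<in> rec_complex \<P>}"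

definition minkowski_weyl :: "'a::real_vector set \<Rightarrow> bool" where
  "minkowski_weyl E \<longleftrightarrow> (\<forall>p\<in>E. rec_at p E = rec_set E)"

end

theory Submission
  imports Defs
begin

text \<open>
  For a non-empty polyhedron \<open>\<Lambda> = {x. a\<^sub>i \<bullet> x \<le> b\<^sub>i}\<close> one has \<open>rec \<Lambda> = {u. a\<^sub>i \<bullet> u \<le> 0}\<close> and
  \<open>c \<Lambda> = {(x, t). t \<ge> 0, a\<^sub>i \<bullet> x \<le> t b\<^sub>i}\<close>, and every face of these cones comes from a face of \<open>\<Lambda>\<close>
  because a functional that is non-negative on \<open>rec \<Lambda>\<close> attains its minimum on \<open>\<Lambda>\<close>.

  The crux is that \<open>rec \<Lambda>\<^sub>1 \<inter> rec \<Lambda>\<^sub>2\<close> is a common face. Take \<open>u\<close> in its relative interior. By the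
  Minkowski-Weyl condition the ray from every point of the support in direction \<open>u\<close> stays in the
  support, so it ends up in some member \<open>\<Lambda>\<close> with \<open>u \<in> rec \<Lambda>\<close>; thus the closed sets
  \<open>\<Lambda> - \<real>\<^sub>\<ge>\<^sub>0 u\<close> with \<open>u \<in> rec \<Lambda>\<close> cover the support. If two of them meet, then so do
  their polyhedra, in a common face whose recession cone contains \<open>u\<close>; hence the two recession cones
  have the same smallest face containing \<open>u\<close>. By connectedness this smallest face is the same for
  \<open>rec \<Lambda>\<^sub>1\<close> and \<open>rec \<Lambda>\<^sub>2\<close>, and it equals their intersection.
\<close>

subsection \<open>H-representations\<close>

definition hrep :: "('a::euclidean_space \<times> real) set \<Rightarrow> 'a set" where
  "hrep I = {x. \<forall>h\<in>I. fst h \<bullet> x \<le> snd h}"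

lemma mem_hrep: "x \<in> hrep I \<longleftrightarrow> (\<forall>h\<in>I. fst h \<bullet> x \<le> snd h)"
  by (simp add: hrep_def)

lemma hrep_insert: "hrep (insert (a, b) I) = hrep I \<inter> {x. a \<bullet> x \<le> b}"
  by (auto simp: hrep_def)

lemma hrep_Un: "hrep (I \<union> J) = hrep I \<inter> hrep J"
  by (auto simp: hrep_def)

lemma polyhedron_iff_hrep: "polyhedron S \<longleftrightarrow> (\<exists>I. finite I \<and> S = hrep I)"
proof
  assume "polyhedron S"
  then obtain F a b where "finite F" "S = \<Inter>F" "\<And>h. h \<in> F \<Longrightarrow> h = {x. a h \<bullet> x \<le> b h}"
    unfolding polyhedron_def by metis
  then have "finite ((\<lambda>h. (a h, b h)) ` F)" "S = hrep ((\<lambda>h. (a h, b h)) ` F)"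
    by (auto simp: hrep_def)
  then show "\<exists>I. finite I \<and> S = hrep I" by blast
next
  assume "\<exists>I. finite I \<and> S = hrep I"
  then obtain I where I: "finite I" "S = hrep I" by blast
  then have "S = \<Inter>((\<lambda>h. {x. fst h \<bullet> x \<le> snd h}) ` I)"
    by (auto simp: hrep_def)
  then show "polyhedron S"
    using I by (auto simp: polyhedron_halfspace_le intro!: polyhedron_Inter)
qed

lemma rational_polyhedron_iff_hrep:
  "rational_polyhedron S \<longleftrightarrow>
     (\<exists>I. finite I \<and> (\<forall>h\<in>I. fst h \<noteq> 0 \<and> rational_vector (fst h) \<and> snd h \<in> \<rat>) \<and> S = hrep I)"
  (is "_ \<longleftrightarrow> (\<exists>I. ?Q I)")
proof
  assume "rational_polyhedron S"
  then obtain F where F: "finite F" "S = \<Inter>F"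
    and "\<forall>h\<in>F. \<exists>a b. a \<noteq> 0 \<and> rational_vector a \<and> b \<in> \<rat> \<and> h = {x. a \<bullet> x \<le> b}"
    unfolding rational_polyhedron_def by blast
  then obtain a b where ab: "\<And>h. h \<in> F \<Longrightarrow>
      a h \<noteq> 0 \<and> rational_vector (a h) \<and> b h \<in> \<rat> \<and> h = {x. a h \<bullet> x \<le> b h}"
    by metis
  have "S = hrep ((\<lambda>h. (a h, b h)) ` F)"
    using F ab by (auto simp: hrep_def)
  then have "?Q ((\<lambda>h. (a h, b h)) ` F)"
    using F(1) ab by auto
  then show "\<exists>I. ?Q I" by blast
next
  assume "\<exists>I. ?Q I"
  then obtain I where I: "?Q I" by blast
  then have "S = \<Inter>((\<lambda>h. {x. fst h \<bullet> x \<le> snd h}) ` I)"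
    by (auto simp: hrep_def)
  moreover have "finite ((\<lambda>h. {x. fst h \<bullet> x \<le> snd h}) ` I)"
    using I by simp
  moreover have "\<exists>a b. a \<noteq> 0 \<and> rational_vector a \<and> b \<in> \<rat> \<and> H = {x. a \<bullet> x \<le> b}"
    if "H \<in> (\<lambda>h. {x. fst h \<bullet> x \<le> snd h}) ` I" for H
    using I that by (elim imageE) blast
  ultimately show "rational_polyhedron S"
    unfolding rational_polyhedron_def
    by (intro exI[of _ "(\<lambda>h. {x. fst h \<bullet> x \<le> snd h}) ` I"] conjI ballI)
qed

lemma rational_vector_Pair:
  "rational_vector (a, b :: real) \<longleftrightarrow> rational_vector a \<and> b \<in> \<rat>"
  by (auto simp: rational_vector_def Basis_prod_def)

lemma rational_vector_0 [simp]: "rational_vector 0"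
  by (simp add: rational_vector_def)

section \<open>Recession cones and cones over a polyhedron given by inequalities\<close>

lemma le_multiples_imp_nonpos:
  fixes \<alpha> \<beta> \<gamma> :: real
  assumes "infinite N" "\<And>n. n \<in> N \<Longrightarrow> \<alpha> + real n * \<beta> \<le> \<gamma>"
  shows "\<beta> \<le> 0"
proof (rule ccontr)
  assume "\<not> \<beta> \<le> 0"
  then have "\<beta> > 0" by simp
  obtain k where k: "(\<gamma> - \<alpha>) / \<beta> < real k" using reals_Archimedean2 by blast
  obtain n where "n \<in> N" "k < n" using assms(1) infinite_nat_iff_unbounded by blast
  then have "(\<gamma> - \<alpha>) / \<beta> < real n" using k by simp
  then show False
    using assms(2)[OF \<open>n \<in> N\<close>] \<open>\<beta> > 0\<close> by (simp add: divide_less_eq)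
qed

text \<open>An inequality whose normal grew along \<open>u\<close> would be violated at large times.
  Membership is demanded only along an infinite set of times, because the pigeonhole argument in
  \<open>ray_eventually_in_member\<close> provides no more.\<close>

lemma ray_direction_hrep:
  assumes "infinite N" "\<And>n. n \<in> N \<Longrightarrow> p + real n *\<^sub>R u \<in> hrep I" "h \<in> I"
  shows "fst h \<bullet> u \<le> 0"
proof (rule le_multiples_imp_nonpos[OF assms(1)])
  fix n assume "n \<in> N"
  then show "fst h \<bullet> p + real n * (fst h \<bullet> u) \<le> snd h"
    using assms(2)[of n] assms(3) by (simp add: mem_hrep inner_add_right)
qed

text \<open>Each inequality is affine along a ray, so it survives for all times exactly if its slope
  is nonpositive. The answer does not involve \<open>p\<close>: a single polyhedron always satisfies
  the Minkowski-Weyl condition.\<close>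

lemma rec_at_hrep:
  assumes "p \<in> hrep I"
  shows "rec_at p (hrep I) = {u. \<forall>h\<in>I. fst h \<bullet> u \<le> 0}"
proof (intro equalityI subsetI)
  fix u assume "u \<in> rec_at p (hrep I)"
  then have "p + real n *\<^sub>R u \<in> hrep I" for n
    by (simp add: rec_at_def)
  then show "u \<in> {u. \<forall>h\<in>I. fst h \<bullet> u \<le> 0}"
    using ray_direction_hrep[of UNIV p u I] by auto
next
  fix u assume u: "u \<in> {u. \<forall>h\<in>I. fst h \<bullet> u \<le> 0}"
  have "fst h \<bullet> p + t * (fst h \<bullet> u) \<le> snd h" if "h \<in> I" "t \<ge> 0" for h t
    using assms u that mult_nonneg_nonpos[of t "fst h \<bullet> u"] by (fastforce simp: mem_hrep)
  then show "u \<in> rec_at p (hrep I)"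
    by (simp add: rec_at_def mem_hrep inner_add_right)
qed

lemma rec_set_hrep:
  assumes "hrep I \<noteq> {}"
  shows "rec_set (hrep I) = {u. \<forall>h\<in>I. fst h \<bullet> u \<le> 0}"
proof -
  have "rec_set (hrep I) = (\<Inter>p\<in>hrep I. {u. \<forall>h\<in>I. fst h \<bullet> u \<le> 0})"
    unfolding rec_set_def by (intro INF_cong refl rec_at_hrep)
  then show ?thesis using assms by simp
qed

text \<open>Homogenising the inequalities gives a closed set whose points of positive height are
  exactly the rays through \<open>(p, 1)\<close>. The points of height zero are limits of these,
  which needs a point of the polyhedron to push them upwards.\<close>

lemma c_set_hrep:
  assumes "hrep I \<noteq> {}"
  shows "c_set (hrep I) = {z. snd z \<ge> 0 \<and> (\<forall>h\<in>I. fst h \<bullet> fst z \<le> snd z * snd h)}"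
    (is "_ = ?C")
proof
  let ?S = "{t *\<^sub>R (p, 1::real) |t p. t > 0 \<and> p \<in> hrep I}"
  have "closed ({z. snd z \<ge> (0::real)} \<inter> (\<Inter>h\<in>I. {z. fst h \<bullet> fst z \<le> snd z * snd h}))"
    by (intro closed_Int closed_INT ballI closed_Collect_le continuous_intros)
  also have "\<dots> = ?C" by auto
  finally have "closed ?C" .
  moreover have "?S \<subseteq> ?C" by (auto simp: mem_hrep)
  ultimately show "c_set (hrep I) \<subseteq> ?C"
    by (simp add: c_set_def closure_minimal)
  show "?C \<subseteq> c_set (hrep I)"
  proof
    fix z assume z: "z \<in> ?C"
    obtain p where p: "p \<in> hrep I" using assms by blast
    have *: "z' \<in> ?S" if "z' \<in> ?C" "snd z' > 0" for z'
    proof -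
      have "(1 / snd z') *\<^sub>R fst z' \<in> hrep I"
        using that by (auto simp: mem_hrep divide_le_eq mult.commute)
      then show ?thesis
        using that by (intro CollectI exI[of _ "snd z'"] exI[of _ "(1 / snd z') *\<^sub>R fst z'"])
          (auto simp: prod_eq_iff)
    qed
    \<comment> \<open>A small multiple of \<open>(p, 1)\<close> preserves the homogeneous
      inequalities and makes the height positive, so that \<open>*\<close> applies.\<close>
    have "z + (1 / real (Suc n)) *\<^sub>R (p, 1) \<in> ?S" for n
    proof (rule *)
      have "fst h \<bullet> fst z + (1 / real (Suc n)) * (fst h \<bullet> p)
              \<le> snd z * snd h + (1 / real (Suc n)) * snd h" if "h \<in> I" for h
        using z p that by (intro add_mono mult_left_mono) (auto simp: mem_hrep)
      then show "z + (1 / real (Suc n)) *\<^sub>R (p, 1) \<in> ?C"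
        using z by (simp add: inner_add_right distrib_right)
      show "snd (z + (1 / real (Suc n)) *\<^sub>R (p, 1)) > 0"
        using z by (auto intro: add_nonneg_pos)
    qed
    moreover have "(\<lambda>n. z + (1 / real (Suc n)) *\<^sub>R (p, 1)) \<longlonglongrightarrow> z + 0 *\<^sub>R (p, 1)"
      using LIMSEQ_inverse_real_of_nat
      by (intro tendsto_intros) (simp add: inverse_eq_divide)
    ultimately show "z \<in> c_set (hrep I)"
      unfolding c_set_def closure_sequential by (metis (no_types, lifting) add_0_right scaleR_zero_left)
  qed
qed

section \<open>Polar duality for finitely generated cones\<close>

lemma dual_convex_cone_hull:
  assumes "\<And>v. v \<in> V \<Longrightarrow> a \<bullet> v \<le> 0" "x \<in> convex_cone hull V"
  shows "a \<bullet> x \<le> 0"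
proof -
  have "convex_cone {x. a \<bullet> x \<le> 0}"
    by (auto simp: convex_cone_iff inner_add_right mult_nonneg_nonpos)
  then have "convex_cone hull V \<subseteq> {x. a \<bullet> x \<le> 0}"
    using assms(1) by (intro hull_minimal) auto
  then show ?thesis using assms(2) by auto
qed

text \<open>The hull is a polyhedron containing 0 and closed under nonnegative scaling, so it is its
  own recession cone at 0. Passing to that recession cone replaces every right-hand side by
  0.\<close>

lemma finitely_generated_cone_eq_dual:
  fixes V :: "'a::euclidean_space set"
  assumes "finite V"
  shows "\<exists>B. finite B \<and> convex_cone hull V = {x. \<forall>b\<in>B. b \<bullet> x \<le> 0}"
proof -
  obtain I where I: "finite I" "convex_cone hull V = hrep I"
    using polyhedron_convex_cone_hull[OF assms] polyhedron_iff_hrep by blast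
  have 0: "0 \<in> hrep I" using I(2) convex_cone_hull_contains_0[of V] by simp
  have "rec_at 0 (hrep I) = hrep I"
  proof (intro equalityI subsetI)
    fix x assume "x \<in> rec_at 0 (hrep I)"
    then have "0 + 1 *\<^sub>R x \<in> hrep I" unfolding rec_at_def using zero_le_one by blast
    then show "x \<in> hrep I" by simp
  next
    fix x assume "x \<in> hrep I"
    then show "x \<in> rec_at 0 (hrep I)"
      using convex_cone_hull_mul[of x V] I(2) by (auto simp: rec_at_def)
  qed
  then have "convex_cone hull V = {x. \<forall>b\<in>fst ` I. b \<bullet> x \<le> 0}"
    using rec_at_hrep[OF 0] I(2) by auto
  then show ?thesis using I(1) by blast
qed

text \<open>Polar duality turns the fact that finitely generated cones are polyhedra into its converse.\<close>

lemma convex_polyhedral_cone_dual: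
  fixes A :: "'a::euclidean_space set"
  assumes "finite A"
  shows "convex_polyhedral_cone {x. \<forall>a\<in>A. a \<bullet> x \<le> 0}"
proof -
  obtain B where B: "finite B" "convex_cone hull A = {x. \<forall>b\<in>B. b \<bullet> x \<le> 0}"
    using finitely_generated_cone_eq_dual[OF assms] by blast
  have "{x. \<forall>a\<in>A. a \<bullet> x \<le> 0} = convex_cone hull B"
  proof (intro equalityI subsetI)
    fix x assume x: "x \<in> convex_cone hull B"
    have "a \<bullet> x \<le> 0" if "a \<in> A" for a
    proof (rule dual_convex_cone_hull[OF _ x])
      fix b assume "b \<in> B"
      then show "a \<bullet> b \<le> 0"
        using B(2) hull_inc[OF that, of convex_cone] by (auto simp: inner_commute)
    qed
    then show "x \<in> {x. \<forall>a\<in>A. a \<bullet> x \<le> 0}" by simp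
  next
    fix x assume x: "x \<in> {x. \<forall>a\<in>A. a \<bullet> x \<le> 0}"
    obtain D where D: "finite D" "convex_cone hull B = {x. \<forall>d\<in>D. d \<bullet> x \<le> 0}"
      using finitely_generated_cone_eq_dual[OF B(1)] by blast
    have "d \<bullet> x \<le> 0" if "d \<in> D" for d
    proof -
      \<comment> \<open>Bipolar argument: \<open>d\<close> is nonpositive on \<open>B\<close>, so
        the choice of \<open>B\<close> puts it into the cone generated by \<open>A\<close>, and
        \<open>x\<close> is nonpositive on that cone.\<close>
      have "\<forall>b\<in>B. b \<bullet> d \<le> 0"
        using D(2) that hull_inc[of _ B convex_cone] by (auto simp: inner_commute)
      then have "d \<in> convex_cone hull A" using B(2) by simp
      moreover have "x \<bullet> a \<le> 0" if "a \<in> A" for a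
        using x that by (simp add: inner_commute)
      ultimately have "x \<bullet> d \<le> 0"
        using dual_convex_cone_hull by blast
      then show ?thesis by (simp add: inner_commute)
    qed
    then show "x \<in> convex_cone hull B" using D(2) by simp
  qed
  then show ?thesis using B(1) by (auto simp: convex_polyhedral_cone_def)
qed

subsection \<open>Faces of recession cones and of cones over polyhedra\<close>

lemma rec_set_Int_halfspace:
  fixes \<Lambda> :: "'a::euclidean_space set"
  assumes "polyhedron \<Lambda>" "\<Lambda> \<inter> {x. a \<bullet> x \<le> b} \<noteq> {}"
  shows "rec_set (\<Lambda> \<inter> {x. a \<bullet> x \<le> b}) = rec_set \<Lambda> \<inter> {u. a \<bullet> u \<le> 0}"
proof -
  obtain I where I: "\<Lambda> = hrep I" using assms(1) polyhedron_iff_hrep by blast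
  then have "hrep (insert (a, b) I) \<noteq> {}" "hrep I \<noteq> {}"
    using assms(2) by (auto simp: hrep_insert)
  from this[THEN rec_set_hrep] show ?thesis
    unfolding I hrep_insert[symmetric] by auto
qed

lemma c_set_Int_halfspace:
  fixes \<Lambda> :: "'a::euclidean_space set"
  assumes "polyhedron \<Lambda>" "\<Lambda> \<inter> {x. a \<bullet> x \<le> b} \<noteq> {}"
  shows "c_set (\<Lambda> \<inter> {x. a \<bullet> x \<le> b}) = c_set \<Lambda> \<inter> {z. a \<bullet> fst z \<le> snd z * b}"
proof -
  obtain I where I: "\<Lambda> = hrep I" using assms(1) polyhedron_iff_hrep by blast
  then have "hrep (insert (a, b) I) \<noteq> {}" "hrep I \<noteq> {}"
    using assms(2) by (auto simp: hrep_insert)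
  from this[THEN c_set_hrep] show ?thesis
    unfolding I hrep_insert[symmetric] by auto
qed

text \<open>Joining two H-representations represents the intersection. The intersection has to be
  non-empty: for disjoint non-empty polyhedra the left side is empty, but the right side contains
  0.\<close>

lemma c_set_Int:
  fixes \<Lambda> :: "'a::euclidean_space set"
  assumes "polyhedron \<Lambda>" "polyhedron \<Lambda>'" "\<Lambda> \<inter> \<Lambda>' \<noteq> {}"
  shows "c_set (\<Lambda> \<inter> \<Lambda>') = c_set \<Lambda> \<inter> c_set \<Lambda>'"
proof -
  obtain I where I: "\<Lambda> = hrep I" using assms(1) polyhedron_iff_hrep by blast
  obtain J where J: "\<Lambda>' = hrep J" using assms(2) polyhedron_iff_hrep by blast
  have "hrep (I \<union> J) \<noteq> {}" "hrep I \<noteq> {}" "hrep J \<noteq> {}"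
    using assms(3) I J by (auto simp: hrep_Un)
  from this[THEN c_set_hrep] show ?thesis
    unfolding I J hrep_Un[symmetric] by auto
qed

lemma rec_set_Int:
  fixes \<Lambda> :: "'a::euclidean_space set"
  assumes "polyhedron \<Lambda>" "polyhedron \<Lambda>'" "\<Lambda> \<inter> \<Lambda>' \<noteq> {}"
  shows "rec_set (\<Lambda> \<inter> \<Lambda>') = rec_set \<Lambda> \<inter> rec_set \<Lambda>'"
proof -
  obtain I where I: "\<Lambda> = hrep I" using assms(1) polyhedron_iff_hrep by blast
  obtain J where J: "\<Lambda>' = hrep J" using assms(2) polyhedron_iff_hrep by blast
  have "hrep (I \<union> J) \<noteq> {}" "hrep I \<noteq> {}" "hrep J \<noteq> {}"
    using assms(3) I J by (auto simp: hrep_Un)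
  from this[THEN rec_set_hrep] show ?thesis
    unfolding I J hrep_Un[symmetric] by auto
qed

lemma convex_polyhedral_cone_imp_polyhedron:
  "convex_polyhedral_cone S \<Longrightarrow> polyhedron S"
  by (auto simp: convex_polyhedral_cone_def polyhedron_convex_cone_hull)

lemma convex_polyhedral_cone_imp_convex_cone:
  "convex_polyhedral_cone S \<Longrightarrow> convex_cone S"
  by (auto simp: convex_polyhedral_cone_def convex_cone_convex_cone_hull)

lemma zero_mem_convex_polyhedral_cone: "convex_polyhedral_cone S \<Longrightarrow> 0 \<in> S"
  using convex_cone_contains_0 convex_polyhedral_cone_imp_convex_cone by blast

lemma convex_polyhedral_cone_rec_set:
  fixes \<Lambda> :: "'a::euclidean_space set"
  assumes "polyhedron \<Lambda>" "\<Lambda> \<noteq> {}"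
  shows "convex_polyhedral_cone (rec_set \<Lambda>)"
proof -
  obtain I where I: "finite I" "\<Lambda> = hrep I" using assms(1) polyhedron_iff_hrep by blast
  then have "rec_set \<Lambda> = {u. \<forall>a\<in>fst ` I. a \<bullet> u \<le> 0}"
    using assms(2) rec_set_hrep[of I] by simp
  then show ?thesis
    using convex_polyhedral_cone_dual[of "fst ` I"] I(1) by simp
qed

lemma convex_polyhedral_cone_c_set:
  fixes \<Lambda> :: "'a::euclidean_space set"
  assumes "polyhedron \<Lambda>" "\<Lambda> \<noteq> {}"
  shows "convex_polyhedral_cone (c_set \<Lambda>)"
proof -
  obtain I where I: "finite I" "\<Lambda> = hrep I" using assms(1) polyhedron_iff_hrep by blast
  let ?A = "insert (0, -1) ((\<lambda>h. (fst h, - snd h)) ` I)"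
  have "c_set \<Lambda> = {z. \<forall>a\<in>?A. a \<bullet> z \<le> 0}"
    using assms(2) I(2) c_set_hrep[of I] by (auto simp: inner_prod_def algebra_simps)
  then show ?thesis
    using convex_polyhedral_cone_dual[of ?A] I(1) by simp
qed

lemma convex_polyhedral_cone_Times_0:
  assumes "convex_polyhedral_cone S"
  shows "convex_polyhedral_cone (S \<times> {0 :: 'b::euclidean_space})"
proof -
  obtain V where V: "finite V" "S = convex_cone hull V"
    using assms convex_polyhedral_cone_def by blast
  have "linear (\<lambda>u. (u, 0 :: 'b))"
    by (intro linearI) auto
  from convex_cone_hull_linear_image[OF this, of V]
  have "S \<times> {0} = convex_cone hull ((\<lambda>u. (u, 0 :: 'b)) ` V)"
    using V(2) by auto
  then show ?thesis
    using V(1) by (auto simp: convex_polyhedral_cone_def)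
qed

section \<open>Horizontal slices of the cone and linear programming\<close>

lemma mem_c_set_nonneg:
  assumes "z \<in> c_set E"
  shows "snd z \<ge> 0"
proof -
  have "c_set E \<subseteq> {z. snd z \<ge> 0}"
    unfolding c_set_def
    by (intro closure_minimal closed_Collect_le continuous_intros) auto
  then show ?thesis using assms by blast
qed

text \<open>A lower bound on \<open>E\<close> becomes a closed homogeneous halfspace containing all
  generating rays, hence their closure. At height zero it says that \<open>x\<close> is
  nonnegative.\<close>

lemma mem_c_set_lower_bound:
  assumes "\<And>q. q \<in> E \<Longrightarrow> m \<le> x \<bullet> q" "z \<in> c_set E"
  shows "snd z * m \<le> x \<bullet> fst z"
proof -
  have "c_set E \<subseteq> {z. snd z * m \<le> x \<bullet> fst z}"
    unfolding c_set_def using assms(1)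
    by (intro closure_minimal closed_Collect_le continuous_intros) auto
  then show ?thesis using assms(2) by blast
qed

lemma mem_c_set_zero:
  fixes \<Lambda> :: "'a::euclidean_space set"
  assumes "polyhedron \<Lambda>" "\<Lambda> \<noteq> {}"
  shows "(y, 0) \<in> c_set \<Lambda> \<longleftrightarrow> y \<in> rec_set \<Lambda>"
proof -
  obtain I where "\<Lambda> = hrep I" using assms(1) polyhedron_iff_hrep by blast
  then show ?thesis using assms(2) by (simp add: c_set_hrep rec_set_hrep)
qed

lemma mem_c_set_pos:
  fixes \<Lambda> :: "'a::euclidean_space set"
  assumes "polyhedron \<Lambda>" "\<Lambda> \<noteq> {}" "t > 0"
  shows "(y, t) \<in> c_set \<Lambda> \<longleftrightarrow> (1 / t) *\<^sub>R y \<in> \<Lambda>"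
proof -
  obtain I where "\<Lambda> = hrep I" using assms(1) polyhedron_iff_hrep by blast
  then show ?thesis using assms(2,3)
    by (simp add: c_set_hrep mem_hrep divide_le_eq mult.commute)
qed

text \<open>Linear programming: a generator of the cone over \<open>\<Lambda>\<close> at positive height with the least
  slope gives a minimiser.\<close>

lemma polyhedron_attains_min:
  fixes \<Lambda> :: "'a::euclidean_space set"
  assumes "polyhedron \<Lambda>" "\<Lambda> \<noteq> {}" and pos: "\<And>u. u \<in> rec_set \<Lambda> \<Longrightarrow> 0 \<le> x \<bullet> u"
  obtains p where "p \<in> \<Lambda>" "\<And>q. q \<in> \<Lambda> \<Longrightarrow> x \<bullet> p \<le> x \<bullet> q"
proof -
  obtain V where V: "finite V" "c_set \<Lambda> = convex_cone hull V"
    using convex_polyhedral_cone_c_set[OF assms(1,2)] convex_polyhedral_cone_def by blast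
  have VC: "v \<in> c_set \<Lambda>" if "v \<in> V" for v
    using that V(2) hull_inc[of v V convex_cone] by simp
  have one: "(q, 1) \<in> c_set \<Lambda>" if "q \<in> \<Lambda>" for q
    using that mem_c_set_pos[OF assms(1,2), of 1 q] by simp
  define W where "W = {v\<in>V. snd v > 0}"
  define m where "m = Min ((\<lambda>v. x \<bullet> fst v / snd v) ` W)"
  have "finite W" using V(1) by (simp add: W_def)
  \<comment> \<open>If no generator had positive height, the whole cone would have height at most
    zero, yet it contains \<open>(q, 1)\<close>.\<close>
  have "W \<noteq> {}"
  proof
    assume "W = {}"
    then have *: "(0, 1) \<bullet> v \<le> 0" if "v \<in> V" for v
    proof -
      have "v \<notin> W" using \<open>W = {}\<close> by blast
      then show ?thesis using that by (simp add: W_def inner_prod_def)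
    qed
    obtain q where "q \<in> \<Lambda>" using assms(2) by blast
    then have "(q, 1) \<in> convex_cone hull V" using one V(2) by simp
    from dual_convex_cone_hull[OF * this] show False by (simp add: inner_prod_def)
  qed
  then have "m \<in> (\<lambda>v. x \<bullet> fst v / snd v) ` W"
    unfolding m_def using \<open>finite W\<close> by (intro Min_in) auto
  then obtain w where w: "w \<in> W" "m = x \<bullet> fst w / snd w" by blast
  \<comment> \<open>This bound passes from the generators to the cone, and at \<open>(q, 1)\<close>
    it reads \<open>m \<le> x \<bullet> q\<close>. Generators of height zero are recession
    directions, where \<open>pos\<close> applies.\<close>
  have *: "(- x, m) \<bullet> v \<le> 0" if "v \<in> V" for v
  proof (cases "snd v > 0")
    case True
    then have "m \<le> x \<bullet> fst v / snd v"
      unfolding m_def using that \<open>finite W\<close> by (intro Min_le) (auto simp: W_def)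
    then show ?thesis
      using True by (simp add: inner_prod_def le_divide_eq)
  next
    case False
    then have "snd v = 0" using mem_c_set_nonneg[OF VC[OF that]] by simp
    moreover have "fst v \<in> rec_set \<Lambda>"
      using VC[OF that] mem_c_set_zero[OF assms(1,2), of "fst v"] calculation
      by (metis prod.collapse)
    ultimately show ?thesis using pos by (simp add: inner_prod_def)
  qed
  show thesis
  proof
    have "(fst w, snd w) \<in> c_set \<Lambda>" using w VC by (simp add: W_def)
    then show "(1 / snd w) *\<^sub>R fst w \<in> \<Lambda>"
      using w mem_c_set_pos[OF assms(1,2), of "snd w" "fst w"] by (simp add: W_def)
    show "x \<bullet> ((1 / snd w) *\<^sub>R fst w) \<le> x \<bullet> q" if "q \<in> \<Lambda>" for q
    proof -
      have "(q, 1) \<in> convex_cone hull V" using one[OF that] V(2) by simp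
      from dual_convex_cone_hull[OF * this] show ?thesis
        using w(2) by (simp add: inner_prod_def)
    qed
  qed
qed

section \<open>Faces as sections by supporting halfspaces\<close>

text \<open>Here \<open>m\<close> is the minimum of \<open>x\<close>. In this form a face arises by
  adding one inequality, so \<open>rec_set_Int_halfspace\<close> and
  \<open>c_set_Int_halfspace\<close> compute its cones.\<close>

lemma is_faceE:
  assumes "is_face F \<Lambda>"
  obtains x m where "\<And>q. q \<in> \<Lambda> \<Longrightarrow> m \<le> x \<bullet> q" "F = \<Lambda> \<inter> {q. x \<bullet> q \<le> m}" "F \<noteq> {}"
proof -
  obtain x where x: "F \<noteq> {}" "F = min_locus \<Lambda> x"
    using assms is_face_def by blast
  then obtain p where p: "p \<in> min_locus \<Lambda> x" by blast
  show thesis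
  proof
    show "x \<bullet> p \<le> x \<bullet> q" if "q \<in> \<Lambda>" for q
      using p that by (auto simp: min_locus_def)
    show "F = \<Lambda> \<inter> {q. x \<bullet> q \<le> x \<bullet> p}"
      using p x(2) by (fastforce simp: min_locus_def)
  qed fact
qed

lemma is_faceI:
  assumes "\<And>q. q \<in> \<Lambda> \<Longrightarrow> m \<le> x \<bullet> q" "F = \<Lambda> \<inter> {q. x \<bullet> q \<le> m}" "F \<noteq> {}"
  shows "is_face F \<Lambda>"
proof -
  have "F = min_locus \<Lambda> x"
    using assms by (fastforce simp: min_locus_def)
  then show ?thesis using assms(3) by (auto simp: is_face_def)
qed

text \<open>All faces of a polyhedron are exposed. Exposed faces are maxima of a functional and
  \<open>min_locus\<close> collects minima, whence the change of sign. The equivalence makes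
  transitivity, products and intersections of faces available.\<close>

lemma is_face_iff_face_of:
  assumes "polyhedron \<Lambda>"
  shows "is_face F \<Lambda> \<longleftrightarrow> F \<noteq> {} \<and> F face_of \<Lambda>"
proof
  assume "is_face F \<Lambda>"
  then obtain x m where xm: "\<And>q. q \<in> \<Lambda> \<Longrightarrow> m \<le> x \<bullet> q" "F = \<Lambda> \<inter> {q. x \<bullet> q \<le> m}" "F \<noteq> {}"
    using is_faceE by blast
  then have "F = \<Lambda> \<inter> {q. x \<bullet> q = m}" by force
  then show "F \<noteq> {} \<and> F face_of \<Lambda>"
    using xm(1,3) assms by (simp add: face_of_Int_supporting_hyperplane_ge polyhedron_imp_convex)
next
  assume F: "F \<noteq> {} \<and> F face_of \<Lambda>"
  then obtain a b where ab: "\<Lambda> \<subseteq> {x. a \<bullet> x \<le> b}" "F = \<Lambda> \<inter> {x. a \<bullet> x = b}"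
    using exposed_face_of_polyhedron[OF assms, of F] exposed_face_of_def[of F \<Lambda>] by blast
  show "is_face F \<Lambda>"
  proof (rule is_faceI)
    show "- b \<le> (- a) \<bullet> q" if "q \<in> \<Lambda>" for q using ab(1) that by auto
    show "F = \<Lambda> \<inter> {q. (- a) \<bullet> q \<le> - b}" using ab by force
    show "F \<noteq> {}" using F by blast
  qed
qed

lemma polyhedron_is_face: "polyhedron \<Lambda> \<Longrightarrow> is_face F \<Lambda> \<Longrightarrow> polyhedron F"
  using is_face_iff_face_of face_of_polyhedron_polyhedron by blast

section \<open>Transfer of faces between a polyhedron and its cones\<close>

text \<open>A functional bounded below on \<open>\<Lambda>\<close> is nonnegative on its recession
  directions, so the functional that cuts out \<open>F\<close> also cuts out
  \<open>rec_set F\<close>, with minimum 0.\<close>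

lemma is_face_rec_set:
  fixes \<Lambda> :: "'a::euclidean_space set"
  assumes "polyhedron \<Lambda>" "is_face F \<Lambda>"
  shows "is_face (rec_set F) (rec_set \<Lambda>)"
proof -
  obtain x m where xm: "\<And>q. q \<in> \<Lambda> \<Longrightarrow> m \<le> x \<bullet> q" "F = \<Lambda> \<inter> {q. x \<bullet> q \<le> m}" "F \<noteq> {}"
    using assms(2) is_faceE by blast
  have ne: "\<Lambda> \<noteq> {}" using xm by blast
  show ?thesis
  proof (rule is_faceI)
    show "0 \<le> x \<bullet> u" if "u \<in> rec_set \<Lambda>" for u
      using mem_c_set_lower_bound[OF xm(1), where z = "(u, 0)"] mem_c_set_zero[OF assms(1) ne, of u] that
      by simp
    show "rec_set F = rec_set \<Lambda> \<inter> {u. x \<bullet> u \<le> 0}"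
      using rec_set_Int_halfspace[OF assms(1)] xm(2,3) by blast
    show "rec_set F \<noteq> {}"
      using convex_polyhedral_cone_rec_set[OF polyhedron_is_face[OF assms] xm(3)]
        zero_mem_convex_polyhedral_cone by blast
  qed
qed

text \<open>The supporting functional \<open>(x, - m)\<close> is the homogenisation of
  \<open>q \<mapsto> x \<bullet> q - m\<close>.\<close>

lemma is_face_c_set:
  fixes \<Lambda> :: "'a::euclidean_space set"
  assumes "polyhedron \<Lambda>" "is_face F \<Lambda>"
  shows "is_face (c_set F) (c_set \<Lambda>)"
proof -
  obtain x m where xm: "\<And>q. q \<in> \<Lambda> \<Longrightarrow> m \<le> x \<bullet> q" "F = \<Lambda> \<inter> {q. x \<bullet> q \<le> m}" "F \<noteq> {}"
    using assms(2) is_faceE by blast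
  show ?thesis
  proof (rule is_faceI)
    show "0 \<le> (x, - m) \<bullet> z" if "z \<in> c_set \<Lambda>" for z
      using mem_c_set_lower_bound[OF xm(1) that] by (simp add: inner_prod_def mult.commute)
    have "c_set F = c_set \<Lambda> \<inter> {z. x \<bullet> fst z \<le> snd z * m}"
      using c_set_Int_halfspace[OF assms(1)] xm(2,3) by blast
    then show "c_set F = c_set \<Lambda> \<inter> {z. (x, - m) \<bullet> z \<le> 0}"
      by (simp add: inner_prod_def mult.commute)
    show "c_set F \<noteq> {}"
      using convex_polyhedral_cone_c_set[OF polyhedron_is_face[OF assms] xm(3)]
        zero_mem_convex_polyhedral_cone by blast
  qed
qed

text \<open>The supporting functional is the height: it is nonnegative on the cone, and its zero
  slice is the recession cone.\<close>

lemma is_face_rec_set_Times_0: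
  fixes \<Lambda> :: "'a::euclidean_space set"
  assumes "polyhedron \<Lambda>" "\<Lambda> \<noteq> {}"
  shows "is_face (rec_set \<Lambda> \<times> {0}) (c_set \<Lambda>)"
proof (rule is_faceI)
  show "0 \<le> (0, 1) \<bullet> z" if "z \<in> c_set \<Lambda>" for z
    using mem_c_set_nonneg[OF that] by (simp add: inner_prod_def)
  show "rec_set \<Lambda> \<times> {0} = c_set \<Lambda> \<inter> {z. (0, 1) \<bullet> z \<le> 0}"
    using mem_c_set_nonneg[of _ \<Lambda>] mem_c_set_zero[OF assms]
    by (fastforce simp: inner_prod_def)
  show "rec_set \<Lambda> \<times> {0} \<noteq> {}"
    using zero_mem_convex_polyhedral_cone[OF convex_polyhedral_cone_rec_set[OF assms]] by blast
qed

text \<open>The minimum \<open>m\<close> on a cone is 0: the point 0 gives \<open>m \<le> 0\<close>,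
  and doubling a minimiser gives \<open>m \<le> 2 * m\<close>.\<close>

lemma is_face_cone:
  assumes "convex_polyhedral_cone K" "is_face G K"
  obtains x where "\<And>z. z \<in> K \<Longrightarrow> 0 \<le> x \<bullet> z" "G = K \<inter> {z. x \<bullet> z \<le> 0}"
proof -
  obtain x m where xm: "\<And>q. q \<in> K \<Longrightarrow> m \<le> x \<bullet> q" "G = K \<inter> {q. x \<bullet> q \<le> m}" "G \<noteq> {}"
    using assms(2) is_faceE by blast
  then obtain u where u: "u \<in> K" "x \<bullet> u = m" by force
  have "2 *\<^sub>R u \<in> K"
    using convex_polyhedral_cone_imp_convex_cone[OF assms(1)] u(1) by (simp add: convex_cone_iff)
  then have "m = 0"
    using xm(1)[of "2 *\<^sub>R u"] xm(1)[OF zero_mem_convex_polyhedral_cone[OF assms(1)]] u(2) by simp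
  then show thesis using that xm by blast
qed

text \<open>A functional supporting the recession cone is nonnegative there, so it attains its
  minimum on \<open>\<Lambda>\<close>; the minimisers form the required face.\<close>

lemma is_face_of_rec_set:
  fixes \<Lambda> :: "'a::euclidean_space set"
  assumes "polyhedron \<Lambda>" "\<Lambda> \<noteq> {}" "is_face G (rec_set \<Lambda>)"
  obtains F where "is_face F \<Lambda>" "G = rec_set F"
proof -
  obtain x where x: "\<And>u. u \<in> rec_set \<Lambda> \<Longrightarrow> 0 \<le> x \<bullet> u" "G = rec_set \<Lambda> \<inter> {u. x \<bullet> u \<le> 0}"
    using is_face_cone[OF convex_polyhedral_cone_rec_set[OF assms(1,2)] assms(3)] by blast
  then obtain p where p: "p \<in> \<Lambda>" "\<And>q. q \<in> \<Lambda> \<Longrightarrow> x \<bullet> p \<le> x \<bullet> q"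
    using polyhedron_attains_min[OF assms(1,2)] by blast
  then have ne: "\<Lambda> \<inter> {q. x \<bullet> q \<le> x \<bullet> p} \<noteq> {}" by blast
  then have "is_face (\<Lambda> \<inter> {q. x \<bullet> q \<le> x \<bullet> p}) \<Lambda>"
    using is_faceI p(2) by blast
  then show thesis
    using that rec_set_Int_halfspace[OF assms(1) ne] x(2) by simp
qed

text \<open>Split the supporting functional as \<open>(x, s)\<close> and let \<open>F\<close> be the
  face of \<open>\<Lambda>\<close> where \<open>x\<close> attains its minimum
  \<open>x \<bullet> p\<close>. Its value \<open>x \<bullet> p + s\<close> at \<open>(p, 1)\<close>
  is nonnegative. If it vanishes, the given face is the cone over \<open>F\<close>; if it is
  positive, the face stays at height zero and is \<open>rec_set F \<times> {0}\<close>.\<close>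

lemma is_face_of_c_set:
  fixes \<Lambda> :: "'a::euclidean_space set"
  assumes "polyhedron \<Lambda>" "\<Lambda> \<noteq> {}" "is_face G (c_set \<Lambda>)"
  obtains F where "is_face F \<Lambda>" "G = c_set F \<or> G = rec_set F \<times> {0}"
proof -
  obtain y where y: "\<And>z. z \<in> c_set \<Lambda> \<Longrightarrow> 0 \<le> y \<bullet> z" "G = c_set \<Lambda> \<inter> {z. y \<bullet> z \<le> 0}"
    using is_face_cone[OF convex_polyhedral_cone_c_set[OF assms(1,2)] assms(3)] by blast
  obtain x s where xs: "y = (x, s)" by fastforce
  have "0 \<le> x \<bullet> u" if "u \<in> rec_set \<Lambda>" for u
    using y(1)[of "(u, 0)"] mem_c_set_zero[OF assms(1,2), of u] that by (simp add: xs)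
  then obtain p where p: "p \<in> \<Lambda>" "\<And>q. q \<in> \<Lambda> \<Longrightarrow> x \<bullet> p \<le> x \<bullet> q"
    using polyhedron_attains_min[OF assms(1,2)] by blast
  define F where "F = \<Lambda> \<inter> {q. x \<bullet> q \<le> x \<bullet> p}"
  have ne: "F \<noteq> {}" using p by (auto simp: F_def)
  then have face: "is_face F \<Lambda>"
    using is_faceI p(2) F_def by blast
  have "(p, 1) \<in> c_set \<Lambda>" using p(1) mem_c_set_pos[OF assms(1,2), of 1 p] by simp
  then have "x \<bullet> p + s \<ge> 0" using y(1) by (fastforce simp: xs)
  then consider "s = - (x \<bullet> p)" | "x \<bullet> p + s > 0" by linarith
  then show thesis
  proof cases
    case 1
    have "c_set F = c_set \<Lambda> \<inter> {z. x \<bullet> fst z \<le> snd z * (x \<bullet> p)}"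
      using c_set_Int_halfspace[OF assms(1)] ne F_def by blast
    then have "G = c_set F"
      using y(2) 1 by (simp add: xs inner_prod_def mult.commute)
    then show thesis using that face by blast
  next
    case 2
    have F: "rec_set F = rec_set \<Lambda> \<inter> {u. x \<bullet> u \<le> 0}"
      using rec_set_Int_halfspace[OF assms(1)] ne F_def by blast
    have zero: "snd z = 0" if "z \<in> G" for z
    proof -
      have z: "z \<in> c_set \<Lambda>" "x \<bullet> fst z + s * snd z \<le> 0"
        using that y(2) by (auto simp: xs inner_prod_def)
      then have "snd z * (x \<bullet> p + s) \<le> 0"
        using mem_c_set_lower_bound[OF p(2) z(1)] by (simp add: algebra_simps)
      then show ?thesis
        using 2 mem_c_set_nonneg[OF z(1)] by (auto simp: mult_le_0_iff)
    qed
    have "(u, 0) \<in> G \<longleftrightarrow> u \<in> rec_set F" for u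
      using y(2) mem_c_set_zero[OF assms(1,2), of u] F by (auto simp: xs)
    then have "G = rec_set F \<times> {0}"
      using zero by fastforce
    then show thesis using that face by blast
  qed
qed

text \<open>Faces of a product are products of faces, and the only non-empty face of
  \<open>{0}\<close> is itself.\<close>

lemma is_face_Times_0:
  fixes S :: "'a::euclidean_space set"
  assumes "convex_polyhedral_cone S"
  shows "is_face G (S \<times> {0 :: 'b::euclidean_space}) \<longleftrightarrow> (\<exists>F. is_face F S \<and> G = F \<times> {0})"
proof -
  have "polyhedron S" "polyhedron (S \<times> {0 :: 'b})"
    using convex_polyhedral_cone_imp_polyhedron[OF assms]
      convex_polyhedral_cone_imp_polyhedron[OF convex_polyhedral_cone_Times_0[OF assms]] by auto
  note iff = this[THEN is_face_iff_face_of]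
  show ?thesis
  proof
    assume "is_face G (S \<times> {0 :: 'b})"
    then have "G \<noteq> {}" "G face_of S \<times> {0}" using iff(2) by auto
    then obtain F F' where F: "G = F \<times> F'" "G \<noteq> {}" "F face_of S" "F' face_of {0 :: 'b}"
      unfolding face_of_Times_decomp by metis
    then have "F' = {0}" "F \<noteq> {}"
      using face_of_imp_subset[OF F(4)] by auto
    then show "\<exists>F. is_face F S \<and> G = F \<times> {0}" using F iff(1)[of F] by auto
  next
    assume "\<exists>F. is_face F S \<and> G = F \<times> {0}"
    then obtain F where "F \<noteq> {}" "F face_of S" "G = F \<times> {0}" using iff(1) by auto
    then show "is_face G (S \<times> {0 :: 'b})"
      using iff(2) by (simp add: face_of_Times_eq face_of_refl)
  qed
qed

subsection \<open>Intersections of recession cones\<close>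

lemma bounded_affine_imp_zero:
  fixes \<alpha> \<beta> \<gamma> :: real
  assumes "\<And>t. \<alpha> + t * \<beta> \<le> \<gamma>"
  shows "\<beta> = 0"
proof (rule ccontr)
  assume "\<beta> \<noteq> 0"
  then show False using assms[of "(\<gamma> - \<alpha> + 1) / \<beta>"] by simp
qed

text \<open>Nonnegative height along a whole line forces its direction \<open>w\<close> to be
  horizontal. Every inequality of \<open>\<Lambda>\<close> is then bounded in both directions along
  \<open>w\<close>, hence constant, so the line can be moved to any point of
  \<open>\<Lambda>\<close>.\<close>

lemma contains_line_c_set:
  fixes \<Lambda> :: "'a::euclidean_space set"
  assumes "polyhedron \<Lambda>" "\<Lambda> \<noteq> {}" "contains_line (c_set \<Lambda>)"
  shows "contains_line \<Lambda>"
proof -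
  obtain I where I: "\<Lambda> = hrep I" using assms(1) polyhedron_iff_hrep by blast
  obtain p w where w: "w \<noteq> 0" "\<And>t. p + t *\<^sub>R w \<in> c_set \<Lambda>"
    using assms(3) contains_line_def by blast
  have C: "0 \<le> snd p + t * snd w"
    "h \<in> I \<Longrightarrow> fst h \<bullet> fst p + t * (fst h \<bullet> fst w) \<le> (snd p + t * snd w) * snd h" for t h
    using w(2)[of t] assms(2) by (auto simp: I c_set_hrep inner_add_right)
  have "- snd p + t * - snd w \<le> 0" for t using C(1)[of t] by simp
  from bounded_affine_imp_zero[OF this] have s: "snd w = 0" by simp
  have "fst h \<bullet> fst w = 0" if "h \<in> I" for h
    using bounded_affine_imp_zero[of "fst h \<bullet> fst p" "fst h \<bullet> fst w" "snd p * snd h"]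
      C(2)[OF that] s by simp
  moreover obtain q where "q \<in> hrep I" using assms(2) I by blast
  ultimately have "q + t *\<^sub>R fst w \<in> \<Lambda>" for t
    by (simp add: I mem_hrep inner_add_right)
  moreover have "fst w \<noteq> 0" using w(1) s by (simp add: prod_eq_iff)
  ultimately show ?thesis unfolding contains_line_def by blast
qed

lemma contains_line_rec_set_Times_0:
  fixes \<Lambda> :: "'a::euclidean_space set"
  assumes "polyhedron \<Lambda>" "\<Lambda> \<noteq> {}" "contains_line (rec_set \<Lambda> \<times> {0 :: real})"
  shows "contains_line \<Lambda>"
proof -
  have "rec_set \<Lambda> \<times> {0} \<subseteq> c_set \<Lambda>" using mem_c_set_zero[OF assms(1,2)] by auto
  then have "contains_line (c_set \<Lambda>)"
    using assms(3) unfolding contains_line_def by blast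
  then show ?thesis using contains_line_c_set[OF assms(1,2)] by blast
qed

lemma contains_line_rec_set:
  fixes \<Lambda> :: "'a::euclidean_space set"
  assumes "polyhedron \<Lambda>" "\<Lambda> \<noteq> {}" "contains_line (rec_set \<Lambda>)"
  shows "contains_line \<Lambda>"
proof -
  obtain p u where u: "u \<noteq> 0" "\<And>t. p + t *\<^sub>R u \<in> rec_set \<Lambda>"
    using assms(3) contains_line_def by blast
  then have "(u, 0 :: real) \<noteq> 0" "(p, 0) + t *\<^sub>R (u, 0 :: real) \<in> rec_set \<Lambda> \<times> {0}" for t
    by (auto simp: prod_eq_iff)
  then have "contains_line (rec_set \<Lambda> \<times> {0 :: real})"
    unfolding contains_line_def by blast
  then show ?thesis using contains_line_rec_set_Times_0[OF assms(1,2)] by blast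
qed

lemma rational_polyhedron_rec_set:
  fixes \<Lambda> :: "'a::euclidean_space set"
  assumes "rational_polyhedron \<Lambda>" "\<Lambda> \<noteq> {}"
  shows "rational_polyhedron (rec_set \<Lambda>)"
proof -
  obtain I where I: "finite I" "\<forall>h\<in>I. fst h \<noteq> 0 \<and> rational_vector (fst h) \<and> snd h \<in> \<rat>"
      "\<Lambda> = hrep I"
    using assms(1) unfolding rational_polyhedron_iff_hrep by blast
  let ?J = "(\<lambda>h. (fst h, 0)) ` I"
  have "rec_set \<Lambda> = hrep ?J"
    using assms(2) rec_set_hrep[of I] unfolding I(3) by (simp add: mem_hrep set_eq_iff)
  moreover have "finite ?J" "\<forall>h\<in>?J. fst h \<noteq> 0 \<and> rational_vector (fst h) \<and> snd h \<in> \<rat>"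
    using I by auto
  ultimately show ?thesis unfolding rational_polyhedron_iff_hrep by blast
qed

text \<open>The right-hand sides become last coordinates of the normals, so their rationality is
  what makes the new normals rational.\<close>

lemma rational_polyhedron_c_set:
  fixes \<Lambda> :: "'a::euclidean_space set"
  assumes "rational_polyhedron \<Lambda>" "\<Lambda> \<noteq> {}"
  shows "rational_polyhedron (c_set \<Lambda>)"
proof -
  obtain I where I: "finite I" "\<forall>h\<in>I. fst h \<noteq> 0 \<and> rational_vector (fst h) \<and> snd h \<in> \<rat>"
      "\<Lambda> = hrep I"
    using assms(1) unfolding rational_polyhedron_iff_hrep by blast
  let ?J = "insert ((0, -1), 0) ((\<lambda>h. ((fst h, - snd h), 0)) ` I)"
  have "c_set \<Lambda> = hrep ?J"
    using assms(2) c_set_hrep[of I] unfolding I(3)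
    by (simp add: mem_hrep set_eq_iff inner_prod_def mult.commute)
  moreover have "finite ?J" "\<forall>h\<in>?J. fst h \<noteq> 0 \<and> rational_vector (fst h) \<and> snd h \<in> \<rat>"
    using I by (auto simp: rational_vector_Pair prod_eq_iff)
  ultimately show ?thesis unfolding rational_polyhedron_iff_hrep by blast
qed

lemma rational_polyhedron_Times_0:
  fixes S :: "'a::euclidean_space set"
  assumes "rational_polyhedron S"
  shows "rational_polyhedron (S \<times> {0 :: real})"
proof -
  obtain I where I: "finite I" "\<forall>h\<in>I. fst h \<noteq> 0 \<and> rational_vector (fst h) \<and> snd h \<in> \<rat>"
      "S = hrep I"
    using assms unfolding rational_polyhedron_iff_hrep by blast
  let ?J = "insert ((0, -1), 0) (insert ((0, 1), 0) ((\<lambda>h. ((fst h, 0 :: real), snd h)) ` I))"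
  have "S \<times> {0} = hrep ?J"
    unfolding I(3) by (auto simp: hrep_def inner_prod_def)
  moreover have "finite ?J" "\<forall>h\<in>?J. fst h \<noteq> 0 \<and> rational_vector (fst h) \<and> snd h \<in> \<rat>"
    using I by (auto simp: rational_vector_Pair prod_eq_iff)
  ultimately show ?thesis unfolding rational_polyhedron_iff_hrep by blast
qed

section \<open>Smallest faces, connectedness and rays\<close>

text \<open>The invariant that is compared between recession cones. For \<open>u\<close> outside
  \<open>C\<close> the family is empty and the value is the whole space.\<close>

definition minimal_face :: "'a::real_vector \<Rightarrow> 'a set \<Rightarrow> 'a set" where
  "minimal_face u C = \<Inter>{F. F face_of C \<and> u \<in> F}"

lemma minimal_face_face_of:
  assumes "convex C" "u \<in> C"
  shows "minimal_face u C face_of C"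
  unfolding minimal_face_def using assms face_of_refl
  by (intro face_of_Inter) auto

lemma mem_minimal_face: "u \<in> minimal_face u C"
  by (simp add: minimal_face_def)

text \<open>A face of \<open>C\<close> meets \<open>F\<close> in a face of \<open>F\<close>, and
  faces of \<open>F\<close> are faces of \<open>C\<close>. Hence two cones with a common face
  through \<open>u\<close> have the same smallest face at \<open>u\<close>.\<close>

lemma minimal_face_of_face:
  assumes "F face_of C" "u \<in> F"
  shows "minimal_face u F = minimal_face u C"
proof
  show "minimal_face u F \<subseteq> minimal_face u C"
    unfolding minimal_face_def
  proof (rule Inter_greatest)
    fix G assume "G \<in> {G. G face_of C \<and> u \<in> G}"
    then have "G \<inter> F face_of F" "u \<in> G \<inter> F"
      using assms face_of_Int face_of_subset face_of_imp_subset
      by (metis (no_types, lifting) inf_le2 mem_Collect_eq) (use \<open>G \<in> _\<close> assms in auto)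
    then show "\<Inter>{G. G face_of F \<and> u \<in> G} \<subseteq> G" by blast
  qed
  show "minimal_face u C \<subseteq> minimal_face u F"
    unfolding minimal_face_def using assms(1) face_of_trans by blast
qed

text \<open>Group the cover by whether \<open>f\<close> takes the value \<open>f i\<close>. Both
  unions are closed by finiteness and disjoint on \<open>E\<close> by \<open>overlap\<close>, so two
  different values would disconnect \<open>E\<close>.\<close>

lemma connected_finite_closed_cover_constant:
  assumes "connected E" "finite J" "E \<subseteq> (\<Union>j\<in>J. C j)" "\<And>j. j \<in> J \<Longrightarrow> closed (C j)"
    and overlap: "\<And>i j x. i \<in> J \<Longrightarrow> j \<in> J \<Longrightarrow> x \<in> E \<Longrightarrow> x \<in> C i \<Longrightarrow> x \<in> C j \<Longrightarrow> f i = f j"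
    and "i \<in> J" "j \<in> J" "E \<inter> C i \<noteq> {}" "E \<inter> C j \<noteq> {}"
  shows "f i = f j"
proof (rule ccontr)
  assume "f i \<noteq> f j"
  define A where "A = (\<Union>k\<in>{k\<in>J. f k = f i}. C k)"
  define B where "B = (\<Union>k\<in>{k\<in>J. f k \<noteq> f i}. C k)"
  have "closed A" "closed B"
    unfolding A_def B_def using assms(2,4) by (auto intro!: closed_UN)
  moreover have "E \<subseteq> A \<union> B" using assms(3) unfolding A_def B_def by blast
  moreover have "A \<inter> B \<inter> E = {}"
  proof (rule ccontr)
    assume "A \<inter> B \<inter> E \<noteq> {}"
    then obtain x k l where "x \<in> E" "k \<in> J" "l \<in> J" "f k = f i" "f l \<noteq> f i" "x \<in> C k" "x \<in> C l"
      unfolding A_def B_def by blast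
    then show False using overlap[of k l x] by simp
  qed
  ultimately have "A \<inter> E = {} \<or> B \<inter> E = {}"
    using connected_closedD[OF assms(1)] by blast
  moreover have "C i \<subseteq> A" "C j \<subseteq> B"
    using assms(6,7) \<open>f i \<noteq> f j\<close> by (auto simp: A_def B_def)
  ultimately show False using assms(8,9) by blast
qed

text \<open>Inequalities that strictly decrease along \<open>u\<close> hold eventually, and finitely
  many of them hold from a common time on. Only those constant along \<open>u\<close> restrict
  \<open>p\<close>, so the set is a polyhedron.\<close>

lemma closed_ray_hits_polyhedron:
  fixes \<Lambda> :: "'a::euclidean_space set"
  assumes "polyhedron \<Lambda>" "\<Lambda> \<noteq> {}" "u \<in> rec_set \<Lambda>"
  shows "closed {p. \<exists>t\<ge>0. p + t *\<^sub>R u \<in> \<Lambda>}"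
proof -
  obtain I where I: "finite I" "\<Lambda> = hrep I" using assms(1) polyhedron_iff_hrep by blast
  have u: "fst h \<bullet> u \<le> 0" if "h \<in> I" for h
    using assms(2,3) I(2) rec_set_hrep[of I] that by auto
  let ?J = "{h\<in>I. fst h \<bullet> u = 0}"
  have "{p. \<exists>t\<ge>0. p + t *\<^sub>R u \<in> \<Lambda>} = hrep ?J"
  proof (intro equalityI subsetI)
    fix p assume "p \<in> {p. \<exists>t\<ge>0. p + t *\<^sub>R u \<in> \<Lambda>}"
    then obtain t where "p + t *\<^sub>R u \<in> \<Lambda>" by blast
    then show "p \<in> hrep ?J"
      by (auto simp: I(2) mem_hrep inner_add_right)
  next
    fix p assume p: "p \<in> hrep ?J"
    have "eventually (\<lambda>t. fst h \<bullet> p + t * (fst h \<bullet> u) \<le> snd h) at_top" if "h \<in> I" for h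
    proof (cases "fst h \<bullet> u = 0")
      case True
      then show ?thesis using p that by (simp add: mem_hrep)
    next
      case False
      then have neg: "fst h \<bullet> u < 0" using u[OF that] by simp
      show ?thesis
        using eventually_ge_at_top[of "(snd h - fst h \<bullet> p) / (fst h \<bullet> u)"]
      proof eventually_elim
        case (elim t)
        then show ?case using neg by (simp add: neg_divide_le_eq)
      qed
    qed
    then have "eventually (\<lambda>t. \<forall>h\<in>I. fst h \<bullet> p + t * (fst h \<bullet> u) \<le> snd h) at_top"
      using I(1) by (simp add: eventually_ball_finite)
    then have "eventually (\<lambda>t. t \<ge> 0 \<and> p + t *\<^sub>R u \<in> \<Lambda>) at_top"
      using eventually_ge_at_top[of 0]
      by eventually_elim (simp add: I(2) mem_hrep inner_add_right)
    then show "p \<in> {p. \<exists>t\<ge>0. p + t *\<^sub>R u \<in> \<Lambda>}"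
      using eventually_happens'[OF trivial_limit_at_top_linorder] by blast
  qed
  moreover have "polyhedron (hrep ?J)"
    using I(1) unfolding polyhedron_iff_hrep by (intro exI[of _ ?J]) simp
  ultimately show ?thesis using polyhedron_imp_closed by metis
qed

lemma rec_set_step:
  assumes "u \<in> rec_set E" "p \<in> E" "t \<ge> 0"
  shows "p + t *\<^sub>R u \<in> E"
  using assms by (auto simp: rec_set_def rec_at_def)

text \<open>By pigeonhole one member \<open>f k\<close> contains the ray at infinitely many integer
  times, which makes \<open>u\<close> a recession direction of it. The ray is in \<open>f k\<close>
  at time \<open>k\<close> already.\<close>

lemma ray_eventually_in_member:
  fixes \<P> :: "'a::euclidean_space set set"
  assumes "finite \<P>" "\<And>\<Lambda>. \<Lambda> \<in> \<P> \<Longrightarrow> polyhedron \<Lambda>" "p \<in> \<Union>\<P>" "u \<in> rec_set (\<Union>\<P>)"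
  obtains \<Lambda> t where "\<Lambda> \<in> \<P>" "u \<in> rec_set \<Lambda>" "t \<ge> 0" "p + t *\<^sub>R u \<in> \<Lambda>"
proof -
  have "\<exists>\<Lambda>\<in>\<P>. p + real n *\<^sub>R u \<in> \<Lambda>" for n
    using rec_set_step[OF assms(4,3), of "real n"] by auto
  then obtain f where f: "\<And>n. f n \<in> \<P>" "\<And>n. p + real n *\<^sub>R u \<in> f n"
    by metis
  have "finite (range f)"
    using f(1) assms(1) by (meson finite_subset image_subsetI)
  then obtain k where "infinite {n. f n = f k}"
    using pigeonhole_infinite[of UNIV f] by auto
  obtain I where I: "f k = hrep I" using assms(2) f(1) polyhedron_iff_hrep by blast
  have "fst h \<bullet> u \<le> 0" if "h \<in> I" for h
  proof (rule ray_direction_hrep[OF \<open>infinite {n. f n = f k}\<close> _ that])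
    show "p + real n *\<^sub>R u \<in> hrep I" if "n \<in> {n. f n = f k}" for n
      using f(2)[of n] that I by simp
  qed
  moreover have "hrep I \<noteq> {}" using f(2)[of k] I by auto
  ultimately have "u \<in> rec_set (f k)"
    by (simp add: I rec_set_hrep)
  then show thesis using that[of "f k" "real k"] f by simp
qed

text \<open>A direction of one member gives a ray in the support from one point only; the
  Minkowski-Weyl condition extends this to all points. Conversely, a ray in the support ends up in a
  member with that direction.\<close>

lemma Union_rec_complex:
  fixes \<P> :: "'a::euclidean_space set set"
  assumes "finite \<P>" "\<P> \<noteq> {}" "\<And>\<Lambda>. \<Lambda> \<in> \<P> \<Longrightarrow> polyhedron \<Lambda> \<and> \<Lambda> \<noteq> {}"
    and "minkowski_weyl (\<Union>\<P>)"
  shows "\<Union>(rec_complex \<P>) = rec_set (\<Union>\<P>)"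
proof (intro equalityI subsetI)
  fix u assume "u \<in> \<Union>(rec_complex \<P>)"
  then obtain \<Lambda> where \<Lambda>: "\<Lambda> \<in> \<P>" "u \<in> rec_set \<Lambda>" by (auto simp: rec_complex_def)
  then obtain p where p: "p \<in> \<Lambda>" using assms(3) by blast
  then have "u \<in> rec_at p (\<Union>\<P>)"
    using \<Lambda> rec_set_step[OF \<Lambda>(2) p] by (auto simp: rec_at_def)
  then show "u \<in> rec_set (\<Union>\<P>)"
    using assms(4) p \<Lambda>(1) by (auto simp: minkowski_weyl_def)
next
  fix u assume u: "u \<in> rec_set (\<Union>\<P>)"
  obtain p where "p \<in> \<Union>\<P>" using assms(2,3) by blast
  then obtain \<Lambda> where "\<Lambda> \<in> \<P>" "u \<in> rec_set \<Lambda>"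
    using ray_eventually_in_member[OF assms(1) _ _ u] assms(3) by metis
  then show "u \<in> \<Union>(rec_complex \<P>)" by (auto simp: rec_complex_def)
qed

lemma polyhedral_complexD:
  assumes "polyhedral_complex \<P>"
  shows "finite \<P>" "\<P> \<noteq> {}"
    and "\<Lambda> \<in> \<P> \<Longrightarrow> polyhedron \<Lambda>" "\<Lambda> \<in> \<P> \<Longrightarrow> \<Lambda> \<noteq> {}"
    and "\<Lambda> \<in> \<P> \<Longrightarrow> is_face F \<Lambda> \<Longrightarrow> F \<in> \<P>"
    and "\<Lambda> \<in> \<P> \<Longrightarrow> \<Lambda>' \<in> \<P> \<Longrightarrow> \<Lambda> \<inter> \<Lambda>' \<noteq> {} \<Longrightarrow> is_face (\<Lambda> \<inter> \<Lambda>') \<Lambda>"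
    and "\<Lambda> \<in> \<P> \<Longrightarrow> \<Lambda>' \<in> \<P> \<Longrightarrow> \<Lambda> \<inter> \<Lambda>' \<noteq> {} \<Longrightarrow> is_face (\<Lambda> \<inter> \<Lambda>') \<Lambda>'"
  using assms unfolding polyhedral_complex_def by metis+

lemma is_face_Int_rec_set:
  fixes \<P> :: "'a::euclidean_space set set"
  assumes complex: "polyhedral_complex \<P>" and "connected (\<Union>\<P>)" "minkowski_weyl (\<Union>\<P>)"
    and "\<Lambda>\<^sub>1 \<in> \<P>" "\<Lambda>\<^sub>2 \<in> \<P>"
  shows "is_face (rec_set \<Lambda>\<^sub>1 \<inter> rec_set \<Lambda>\<^sub>2) (rec_set \<Lambda>\<^sub>1)"
proof -
  note fin = polyhedral_complexD(1,2)[OF complex]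
  note poly = polyhedral_complexD(3,4)[OF complex]
  have cone: "convex_polyhedral_cone (rec_set \<Lambda>)" if "\<Lambda> \<in> \<P>" for \<Lambda>
    using convex_polyhedral_cone_rec_set poly that by blast
  have conv: "convex (rec_set \<Lambda>)" if "\<Lambda> \<in> \<P>" for \<Lambda>
    using convex_polyhedral_cone_imp_convex_cone[OF cone[OF that]] by (simp add: convex_cone_def)
  let ?K = "rec_set \<Lambda>\<^sub>1 \<inter> rec_set \<Lambda>\<^sub>2"
  have "0 \<in> ?K" using zero_mem_convex_polyhedral_cone cone assms(4,5) by blast
  moreover have convK: "convex ?K" using conv assms(4,5) convex_Int by blast
  ultimately have "rel_interior ?K \<noteq> {}" using rel_interior_eq_empty by blast
  then obtain u where u: "u \<in> rel_interior ?K" by blast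
  then have uK: "u \<in> ?K" using rel_interior_subset by blast
  define J where "J = {\<Lambda>\<in>\<P>. u \<in> rec_set \<Lambda>}"
  define C where "C \<Lambda> = {p. \<exists>t\<ge>0. p + t *\<^sub>R u \<in> \<Lambda>}" for \<Lambda>
  have sub: "\<Lambda> \<subseteq> C \<Lambda>" for \<Lambda>
    unfolding C_def by (auto intro!: exI[of _ 0])
  have "u \<in> \<Union>(rec_complex \<P>)" using uK assms(4) by (auto simp: rec_complex_def)
  then have uE: "u \<in> rec_set (\<Union>\<P>)"
    using Union_rec_complex[OF fin _ assms(3)] poly by blast
  have "minimal_face u (rec_set \<Lambda>\<^sub>1) = minimal_face u (rec_set \<Lambda>\<^sub>2)"
  proof (rule connected_finite_closed_cover_constant[OF assms(2), where C = C and J = J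
        and i = "\<Lambda>\<^sub>1" and j = "\<Lambda>\<^sub>2" and f = "\<lambda>\<Lambda>. minimal_face u (rec_set \<Lambda>)"])
    show "finite J" using fin by (simp add: J_def)
    show "\<Lambda>\<^sub>1 \<in> J" "\<Lambda>\<^sub>2 \<in> J" using assms(4,5) uK by (auto simp: J_def)
    show "\<Union>\<P> \<inter> C \<Lambda>\<^sub>1 \<noteq> {}" "\<Union>\<P> \<inter> C \<Lambda>\<^sub>2 \<noteq> {}"
      using assms(4,5) poly(2) sub by blast+
    show "closed (C \<Lambda>)" if "\<Lambda> \<in> J" for \<Lambda>
      using that poly closed_ray_hits_polyhedron unfolding C_def J_def by blast
    show "\<Union>\<P> \<subseteq> (\<Union>\<Lambda>\<in>J. C \<Lambda>)"
    proof
      fix p assume "p \<in> \<Union>\<P>"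
      then obtain \<Lambda> t where "\<Lambda> \<in> \<P>" "u \<in> rec_set \<Lambda>" "t \<ge> 0" "p + t *\<^sub>R u \<in> \<Lambda>"
        using ray_eventually_in_member[OF fin(1) poly(1) _ uE] by metis
      then show "p \<in> (\<Union>\<Lambda>\<in>J. C \<Lambda>)" unfolding J_def C_def by blast
    qed
    fix \<Lambda> \<Lambda>' p
    assume "\<Lambda> \<in> J" "\<Lambda>' \<in> J" and p: "p \<in> C \<Lambda>" "p \<in> C \<Lambda>'"
    then have \<Lambda>: "\<Lambda> \<in> \<P>" "u \<in> rec_set \<Lambda>" and \<Lambda>': "\<Lambda>' \<in> \<P>" "u \<in> rec_set \<Lambda>'"
      by (auto simp: J_def)
    obtain t t' where t: "t \<ge> 0" "p + t *\<^sub>R u \<in> \<Lambda>" and t': "t' \<ge> 0" "p + t' *\<^sub>R u \<in> \<Lambda>'"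
      using p by (auto simp: C_def)
    \<comment> \<open>Following each ray further by the other's time brings both polyhedra to the
      same point.\<close>
    have "p + (t + t') *\<^sub>R u \<in> \<Lambda>"
      using rec_set_step[OF \<Lambda>(2) t(2) t'(1)] by (simp add: scaleR_left_distrib add.assoc)
    moreover have "p + (t + t') *\<^sub>R u \<in> \<Lambda>'"
      using rec_set_step[OF \<Lambda>'(2) t'(2) t(1)] by (simp add: scaleR_left_distrib add_ac)
    ultimately have ne: "\<Lambda> \<inter> \<Lambda>' \<noteq> {}" by blast
    note F = polyhedral_complexD(6,7)[OF complex \<Lambda>(1) \<Lambda>'(1) ne]
    have uF: "u \<in> rec_set (\<Lambda> \<inter> \<Lambda>')"
      using rec_set_Int[OF poly(1)[OF \<Lambda>(1)] poly(1)[OF \<Lambda>'(1)] ne] \<Lambda>(2) \<Lambda>'(2) by blast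
    \<comment> \<open>The recession cone of the common face is a face of both recession cones and
      contains \<open>u\<close>, so \<open>minimal_face_of_face\<close> applies twice.\<close>
    have "rec_set (\<Lambda> \<inter> \<Lambda>') face_of rec_set \<Lambda>"
      using is_face_rec_set[OF poly(1)[OF \<Lambda>(1)] F(1)]
        is_face_iff_face_of[OF convex_polyhedral_cone_imp_polyhedron[OF cone[OF \<Lambda>(1)]]] by blast
    moreover have "rec_set (\<Lambda> \<inter> \<Lambda>') face_of rec_set \<Lambda>'"
      using is_face_rec_set[OF poly(1)[OF \<Lambda>'(1)] F(2)]
        is_face_iff_face_of[OF convex_polyhedral_cone_imp_polyhedron[OF cone[OF \<Lambda>'(1)]]] by blast
    ultimately show "minimal_face u (rec_set \<Lambda>) = minimal_face u (rec_set \<Lambda>')"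
      using minimal_face_of_face[OF _ uF] by metis
  qed
  moreover have min: "minimal_face u (rec_set \<Lambda>\<^sub>1) face_of rec_set \<Lambda>\<^sub>1"
    "minimal_face u (rec_set \<Lambda>\<^sub>2) face_of rec_set \<Lambda>\<^sub>2"
    using minimal_face_face_of conv assms(4,5) uK by blast+
  ultimately have "minimal_face u (rec_set \<Lambda>\<^sub>1) \<subseteq> ?K"
    using face_of_imp_subset by blast
  \<comment> \<open>A face that contains a relative interior point of \<open>?K\<close> contains all
    of \<open>?K\<close>; this is why \<open>u\<close> was chosen there.\<close>
  moreover have "?K \<subseteq> minimal_face u (rec_set \<Lambda>\<^sub>1)"
    using subset_of_face_of[OF min(1), of ?K] u mem_minimal_face[of u] by blast
  ultimately have "minimal_face u (rec_set \<Lambda>\<^sub>1) = ?K" by (rule subset_antisym)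
  then have "?K face_of rec_set \<Lambda>\<^sub>1" using min(1) by simp
  then show ?thesis
    using is_face_iff_face_of[OF convex_polyhedral_cone_imp_polyhedron[OF cone[OF assms(4)]]] uK
    by blast
qed

subsection \<open>The complexes of recession cones and of cones\<close>

lemma rec_complex_image: "rec_complex \<P> = rec_set ` \<P>"
  by (auto simp: rec_complex_def)

lemma c_complex_image: "c_complex \<P> = c_set ` \<P> \<union> (\<lambda>\<Lambda>. rec_set \<Lambda> \<times> {0}) ` \<P>"
  by (auto simp: c_complex_def rec_complex_def)

text \<open>Cones share 0, so the disjoint case never arises, and one face relation suffices because
  the other follows by exchanging the cones.\<close>

lemma conic_complexI:
  assumes "finite \<Q>" "\<Q> \<noteq> {}" "\<And>\<sigma>. \<sigma> \<in> \<Q> \<Longrightarrow> convex_polyhedral_cone \<sigma>"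
    and "\<And>\<sigma> F. \<sigma> \<in> \<Q> \<Longrightarrow> is_face F \<sigma> \<Longrightarrow> F \<in> \<Q>"
    and "\<And>\<sigma> \<tau>. \<sigma> \<in> \<Q> \<Longrightarrow> \<tau> \<in> \<Q> \<Longrightarrow> is_face (\<sigma> \<inter> \<tau>) \<sigma>"
  shows "conic_complex \<Q>"
proof -
  have "polyhedron \<sigma> \<and> \<sigma> \<noteq> {}" if "\<sigma> \<in> \<Q>" for \<sigma>
    using convex_polyhedral_cone_imp_polyhedron zero_mem_convex_polyhedral_cone assms(3)[OF that]
    by blast
  moreover have "is_face (\<sigma> \<inter> \<tau>) \<sigma> \<and> is_face (\<sigma> \<inter> \<tau>) \<tau>" if "\<sigma> \<in> \<Q>" "\<tau> \<in> \<Q>" for \<sigma> \<tau>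
    using assms(5)[OF that] assms(5)[OF that(2,1)] by (simp add: Int_commute)
  ultimately have "polyhedral_complex \<Q>"
    unfolding polyhedral_complex_def using assms(1,2,4) by (intro conjI ballI allI impI) auto
  then show ?thesis using assms(3) by (simp add: conic_complex_def)
qed

lemma conic_complex_rec_complex:
  fixes \<P> :: "'a::euclidean_space set set"
  assumes complex: "polyhedral_complex \<P>" and "connected (\<Union>\<P>)" "minkowski_weyl (\<Union>\<P>)"
  shows "conic_complex (rec_complex \<P>)"
proof (rule conic_complexI)
  note poly = polyhedral_complexD(3,4)[OF complex]
  show "finite (rec_complex \<P>)" "rec_complex \<P> \<noteq> {}"
    using polyhedral_complexD(1,2)[OF complex] by (auto simp: rec_complex_image)
  show "convex_polyhedral_cone \<sigma>" if "\<sigma> \<in> rec_complex \<P>" for \<sigma>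
    using that poly convex_polyhedral_cone_rec_set by (auto simp: rec_complex_image)
  show "G \<in> rec_complex \<P>" if \<sigma>: "\<sigma> \<in> rec_complex \<P>" "is_face G \<sigma>" for \<sigma> G
  proof -
    obtain \<Lambda> where \<Lambda>: "\<Lambda> \<in> \<P>" "\<sigma> = rec_set \<Lambda>" using \<sigma>(1) by (auto simp: rec_complex_image)
    obtain F where "is_face F \<Lambda>" "G = rec_set F"
      using is_face_of_rec_set[OF poly[OF \<Lambda>(1)]] \<sigma>(2) \<Lambda>(2) by metis
    then show ?thesis
      using polyhedral_complexD(5)[OF complex \<Lambda>(1)] by (auto simp: rec_complex_image)
  qed
  show "is_face (\<sigma> \<inter> \<tau>) \<sigma>" if "\<sigma> \<in> rec_complex \<P>" "\<tau> \<in> rec_complex \<P>" for \<sigma> \<tau>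
    using that is_face_Int_rec_set[OF assms] by (auto simp: rec_complex_image)
qed

lemma is_face_trans:
  assumes "polyhedron \<Lambda>" "is_face F \<Lambda>" "is_face G F"
  shows "is_face G \<Lambda>"
  using assms is_face_iff_face_of[OF assms(1)] is_face_iff_face_of[OF polyhedron_is_face[OF assms(1,2)]]
    face_of_trans by metis

lemma c_set_Int_Times_0:
  fixes \<Lambda> :: "'a::euclidean_space set"
  assumes "polyhedron \<Lambda>" "\<Lambda> \<noteq> {}"
  shows "c_set \<Lambda> \<inter> (S \<times> {0}) = (rec_set \<Lambda> \<inter> S) \<times> {0}"
  using mem_c_set_zero[OF assms] by auto

text \<open>A common point of positive height would rescale to a common point of the polyhedra.
  Disjoint polyhedra may still share recession directions, so the intersection at height zero can be
  nontrivial.\<close>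

lemma c_set_Int_disjoint:
  fixes \<Lambda> :: "'a::euclidean_space set"
  assumes "polyhedron \<Lambda>" "\<Lambda> \<noteq> {}" "polyhedron \<Lambda>'" "\<Lambda>' \<noteq> {}" "\<Lambda> \<inter> \<Lambda>' = {}"
  shows "c_set \<Lambda> \<inter> c_set \<Lambda>' = (rec_set \<Lambda> \<inter> rec_set \<Lambda>') \<times> {0}"
proof -
  have "t = 0" if "(y, t) \<in> c_set \<Lambda>" "(y, t) \<in> c_set \<Lambda>'" for y t
  proof (rule ccontr)
    assume "t \<noteq> 0"
    then have "t > 0" using mem_c_set_nonneg[OF that(1)] by simp
    then have "(1 / t) *\<^sub>R y \<in> \<Lambda> \<inter> \<Lambda>'"
      using that mem_c_set_pos[OF assms(1,2)] mem_c_set_pos[OF assms(3,4)] by blast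
    then show False using assms(5) by blast
  qed
  then have "z \<in> c_set \<Lambda> \<inter> c_set \<Lambda>' \<longleftrightarrow> z \<in> (rec_set \<Lambda> \<inter> rec_set \<Lambda>') \<times> {0}" for z
    using mem_c_set_zero[OF assms(1,2)] mem_c_set_zero[OF assms(3,4)] by (cases z) auto
  then show ?thesis by blast
qed

lemma conic_complex_c_complex:
  fixes \<P> :: "'a::euclidean_space set set"
  assumes complex: "polyhedral_complex \<P>" and "connected (\<Union>\<P>)" "minkowski_weyl (\<Union>\<P>)"
  shows "conic_complex (c_complex \<P>)"
proof (rule conic_complexI)
  note poly = polyhedral_complexD(3,4)[OF complex]
  note rec_cone = convex_polyhedral_cone_rec_set[OF poly]
  note c_cone = convex_polyhedral_cone_c_set[OF poly]
  show "finite (c_complex \<P>)" "c_complex \<P> \<noteq> {}"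
    using polyhedral_complexD(1,2)[OF complex] by (auto simp: c_complex_image)
  show "convex_polyhedral_cone \<sigma>" if "\<sigma> \<in> c_complex \<P>" for \<sigma>
    using that rec_cone c_cone convex_polyhedral_cone_Times_0 by (auto simp: c_complex_image)
  show "G \<in> c_complex \<P>" if \<sigma>: "\<sigma> \<in> c_complex \<P>" "is_face G \<sigma>" for \<sigma> G
  proof -
    obtain \<Lambda> where \<Lambda>: "\<Lambda> \<in> \<P>" "\<sigma> = c_set \<Lambda> \<or> \<sigma> = rec_set \<Lambda> \<times> {0}"
      using \<sigma>(1) by (auto simp: c_complex_image)
    from \<Lambda>(2) have "\<exists>F. is_face F \<Lambda> \<and> (G = c_set F \<or> G = rec_set F \<times> {0})"
    proof
      assume "\<sigma> = c_set \<Lambda>"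
      then show ?thesis using is_face_of_c_set[OF poly[OF \<Lambda>(1)]] \<sigma>(2) by metis
    next
      assume "\<sigma> = rec_set \<Lambda> \<times> {0}"
      then obtain H where "is_face H (rec_set \<Lambda>)" "G = H \<times> {0}"
        using \<sigma>(2) is_face_Times_0[OF rec_cone[OF \<Lambda>(1) \<Lambda>(1)]] by metis
      then show ?thesis using is_face_of_rec_set[OF poly[OF \<Lambda>(1)]] by metis
    qed
    then show ?thesis
      using polyhedral_complexD(5)[OF complex \<Lambda>(1)] by (auto simp: c_complex_image)
  qed
  show "is_face (\<sigma> \<inter> \<tau>) \<sigma>" if \<sigma>: "\<sigma> \<in> c_complex \<P>" "\<tau> \<in> c_complex \<P>" for \<sigma> \<tau>
  proof -
    obtain \<Lambda> where \<Lambda>: "\<Lambda> \<in> \<P>" "\<sigma> = c_set \<Lambda> \<or> \<sigma> = rec_set \<Lambda> \<times> {0}"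
      using \<sigma>(1) by (auto simp: c_complex_image)
    obtain \<Lambda>' where \<Lambda>': "\<Lambda>' \<in> \<P>" "\<tau> = c_set \<Lambda>' \<or> \<tau> = rec_set \<Lambda>' \<times> {0}"
      using \<sigma>(2) by (auto simp: c_complex_image)
    note p = poly[OF \<Lambda>(1)] and p' = poly[OF \<Lambda>'(1)]
    let ?K = "rec_set \<Lambda> \<inter> rec_set \<Lambda>'"
    have K: "is_face (?K \<times> {0}) (rec_set \<Lambda> \<times> {0 :: real})"
      using is_face_Int_rec_set[OF assms \<Lambda>(1) \<Lambda>'(1)] is_face_Times_0[OF rec_cone[OF \<Lambda>(1) \<Lambda>(1)]]
      by metis
    \<comment> \<open>The bottom slice is a face of the cone over \<open>\<Lambda>\<close>, so
      transitivity lifts the face relation to that cone.\<close>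
    then have Kc: "is_face (?K \<times> {0}) (c_set \<Lambda>)"
      using is_face_trans is_face_rec_set_Times_0[OF p]
        convex_polyhedral_cone_imp_polyhedron[OF c_cone[OF \<Lambda>(1) \<Lambda>(1)]] by metis
    \<comment> \<open>In the first case the intersection is the cone over the common face; in all
      the others it is \<open>?K \<times> {0}\<close>.\<close>
    consider "\<sigma> = c_set \<Lambda>" "\<tau> = c_set \<Lambda>'" "\<Lambda> \<inter> \<Lambda>' \<noteq> {}"
      | "\<sigma> = c_set \<Lambda>" "\<tau> = c_set \<Lambda>'" "\<Lambda> \<inter> \<Lambda>' = {}"
      | "\<sigma> = c_set \<Lambda>" "\<tau> = rec_set \<Lambda>' \<times> {0}"
      | "\<sigma> = rec_set \<Lambda> \<times> {0}" "\<tau> = c_set \<Lambda>'"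
      | "\<sigma> = rec_set \<Lambda> \<times> {0}" "\<tau> = rec_set \<Lambda>' \<times> {0}"
      using \<Lambda>(2) \<Lambda>'(2) by blast
    then show ?thesis
    proof cases
      case 1
      then show ?thesis
        using is_face_c_set[OF p(1) polyhedral_complexD(6)[OF complex \<Lambda>(1) \<Lambda>'(1)]]
          c_set_Int[OF p(1) p'(1)] by simp
    next
      case 2
      then show ?thesis using Kc c_set_Int_disjoint[OF p p'] by simp
    next
      case 3
      then show ?thesis using Kc c_set_Int_Times_0[OF p] by simp
    next
      case 4
      have "\<sigma> \<inter> \<tau> = ?K \<times> {0}"
        using 4 c_set_Int_Times_0[OF p', of "rec_set \<Lambda>"] by (simp add: Int_commute)
      then show ?thesis using K 4 by simp
    next
      case 5
      then have "\<sigma> \<inter> \<tau> = ?K \<times> {0}" by blast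
      then show ?thesis using K 5 by simp
    qed
  qed
qed

text \<open>Closure commutes with finite unions.\<close>

lemma c_set_Union:
  assumes "finite \<P>"
  shows "c_set (\<Union>\<P>) = (\<Union>\<Lambda>\<in>\<P>. c_set \<Lambda>)"
  using assms
proof induction
  case empty
  then show ?case by (simp add: c_set_def)
next
  case (insert \<Lambda> \<P>)
  have "{t *\<^sub>R (p, 1::real) |t p. t > 0 \<and> p \<in> \<Lambda> \<union> \<Union>\<P>}
      = {t *\<^sub>R (p, 1) |t p. t > 0 \<and> p \<in> \<Lambda>} \<union> {t *\<^sub>R (p, 1) |t p. t > 0 \<and> p \<in> \<Union>\<P>}"
    by blast
  from arg_cong[OF this, of closure]
  have "c_set (\<Lambda> \<union> \<Union>\<P>) = c_set \<Lambda> \<union> c_set (\<Union>\<P>)"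
    unfolding c_set_def closure_Un .
  then show ?case using insert.IH by simp
qed

text \<open>The cones at height zero lie in the cones over their polyhedra, so they add nothing to
  the support.\<close>

lemma Union_c_complex:
  fixes \<P> :: "'a::euclidean_space set set"
  assumes "finite \<P>" "\<And>\<Lambda>. \<Lambda> \<in> \<P> \<Longrightarrow> polyhedron \<Lambda>" "\<And>\<Lambda>. \<Lambda> \<in> \<P> \<Longrightarrow> \<Lambda> \<noteq> {}"
  shows "\<Union>(c_complex \<P>) = c_set (\<Union>\<P>)"
proof -
  have "rec_set \<Lambda> \<times> {0} \<subseteq> c_set \<Lambda>" if "\<Lambda> \<in> \<P>" for \<Lambda>
    using mem_c_set_zero[OF assms(2,3)[OF that]] by auto
  then show ?thesis
    unfolding c_set_Union[OF assms(1)] c_complex_image by blast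
qed

theorem theorem3p4:
  fixes \<P> :: "(real ^ 'n) set set"
  assumes "polyhedral_complex \<P>"
    and "polyhedral_set (\<Union>\<P>)"
    and "connected (\<Union>\<P>)"
    and "minkowski_weyl (\<Union>\<P>)"
  shows "(conic_complex (rec_complex \<P>) \<and> \<Union>(rec_complex \<P>) = rec_set (\<Union>\<P>)) \<and>
    (conic_complex (c_complex \<P>) \<and> \<Union>(c_complex \<P>) \<subseteq> UNIV \<times> {0..} \<and>
       \<Union>(c_complex \<P>) = c_set (\<Union>\<P>)) \<and>
    (rational_complex \<P> \<longrightarrow>
       rational_complex (rec_complex \<P>) \<and> rational_complex (c_complex \<P>)) \<and>
    (strongly_convex_complex \<P> \<longrightarrow> fan (rec_complex \<P>) \<and> fan (c_complex \<P>))"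
proof (intro conjI impI)
  note fin = polyhedral_complexD(1,2)[OF assms(1)]
  note poly = polyhedral_complexD(3,4)[OF assms(1)]
  show rec: "conic_complex (rec_complex \<P>)"
    using conic_complex_rec_complex assms by blast
  show c: "conic_complex (c_complex \<P>)"
    using conic_complex_c_complex assms by blast
  show "\<Union>(rec_complex \<P>) = rec_set (\<Union>\<P>)"
    using Union_rec_complex[OF fin _ assms(4)] poly by blast
  show c_Union: "\<Union>(c_complex \<P>) = c_set (\<Union>\<P>)"
    using Union_c_complex[OF fin(1)] poly by blast
  show "\<Union>(c_complex \<P>) \<subseteq> UNIV \<times> {0..}"
    unfolding c_Union using mem_c_set_nonneg[of _ "\<Union>\<P>"] by auto
  have complexes: "polyhedral_complex (rec_complex \<P>)" "polyhedral_complex (c_complex \<P>)"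
    using rec c by (auto simp: conic_complex_def)
  {
    assume "rational_complex \<P>"
    then have rat: "rational_polyhedron \<Lambda>" if "\<Lambda> \<in> \<P>" for \<Lambda>
      using that by (simp add: rational_complex_def)
    show "rational_complex (rec_complex \<P>)"
      using complexes(1) rat poly(2) rational_polyhedron_rec_set
      by (auto simp: rational_complex_def rec_complex_image)
    show "rational_complex (c_complex \<P>)"
      using complexes(2) rat poly(2)
      by (auto simp: rational_complex_def c_complex_image rational_polyhedron_rec_set
          rational_polyhedron_c_set rational_polyhedron_Times_0)
  next
    assume "strongly_convex_complex \<P>"
    then have line: "\<not> contains_line \<Lambda>" if "\<Lambda> \<in> \<P>" for \<Lambda>
      using that by (simp add: strongly_convex_complex_def)
    show "fan (rec_complex \<P>)"
      using complexes(1) rec line poly contains_line_rec_set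
      by (auto simp: fan_def strongly_convex_complex_def rec_complex_image)
    have "\<not> contains_line (c_set \<Lambda>)" "\<not> contains_line (rec_set \<Lambda> \<times> {0 :: real})" if "\<Lambda> \<in> \<P>" for \<Lambda>
      using line[OF that] contains_line_c_set[OF poly[OF that]]
        contains_line_rec_set_Times_0[OF poly[OF that]] by auto
    then show "fan (c_complex \<P>)"
      using complexes(2) c by (auto simp: fan_def strongly_convex_complex_def c_complex_image)
  }
qed

end
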